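(* Let $p>3$ be a prime. Then $$\sum_{n=0}^{p-1}\big(3(2n+1)^5-2(2n+1)^3-(2n+1)\big)\frac{T_n^2}{16^n}\equiv -8p^4+8p^6\pmod{p^8}.$$
   Context: $T_n=\sum_{k=0}^n\binom nk^2\binom{2k}n^2$. A congruence $\alpha\equiv\beta\pmod{p^m}$ between rational numbers with denominators prime to $p$ means that $(\alpha-\beta)/p^m$ is a rational number with denominator prime to $p$. *)

theory Defs
  imports Complex_Main "HOL-Computational_Algebra.Primes"
begin

definition T :: "nat \<Rightarrow> nat" where
  "T n = (\<Sum>k=0..n. (n choose k)\<^sup>2 * ((2 * k) choose n)\<^sup>2)"

text \<open>\<open>quotient_of\<close> yields the fraction in lowest terms with positive denominator.\<close>

definition denom_prime_to :: "nat \<Rightarrow> rat \<Rightarrow> bool" where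
  "denom_prime_to p x \<longleftrightarrow> coprime (snd (quotient_of x)) (int p)"

text \<open>The congruence is only meaningful between rationals whose denominators are prime to \<open>p\<close>;
  this requirement is part of the relation, with modulus \<open>p ^ m\<close>.\<close>

definition rat_cong :: "nat \<Rightarrow> nat \<Rightarrow> rat \<Rightarrow> rat \<Rightarrow> bool" where
  "rat_cong p m a b \<longleftrightarrow>
     denom_prime_to p a \<and> denom_prime_to p b \<and> denom_prime_to p ((a - b) / of_nat p ^ m)"

end

theory Submission
  imports Defs "HOL-Number_Theory.Residues"
begin

text \<open>
  The sum telescopes. Creative telescoping shows that \<open>T\<close> satisfies the three-term recurrence
  \<open>(n+1)^3 T(n+1) = 4(2n+1)(3n^2+3n+1) T(n) - 16 n^3 T(n-1)\<close> (\<open>T_recurrence\<close>). A quadratic form in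
  \<open>T(N)\<close> and \<open>T(N-1)\<close> with polynomial coefficients, divided by \<open>16^N\<close>, then has the summand of the theorem as its
  difference (\<open>weighted_sum_T_squared\<close>), so that the sum up to \<open>p-1\<close> equals
  \<open>-2 (p^6 (T(p)^2 + 16 T(p-1)^2) - 8 p^4 (3p^2-2) T(p) T(p-1)) / 16^p\<close>.
  Because of the factors \<open>p^6\<close> and \<open>p^4\<close> the theorem modulo \<open>p^8\<close> only needs
  \<open>T(p) = 4\<close> and \<open>T(p-1) = 16^(p-1)\<close> modulo \<open>p^2\<close>, and
  \<open>T(p) T(p-1) = 4 * 16^(p-1)\<close> modulo \<open>p^4\<close> (\<open>T_values\<close>).

  To obtain these, put \<open>p = 2m+1\<close>. In \<open>T(p)\<close> and in \<open>T(p-1)\<close> only about half of the terms are nonzero.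
  One of those is the square of a central binomial coefficient, and each of the others carries a factor
  \<open>p^2\<close>, so that its cofactor matters modulo \<open>p^2\<close> only, where the binomial coefficients are given by
  harmonic numbers. For the central terms, write \<open>h(s)\<close> for the sum of \<open>1/i^s\<close> over \<open>i \<le> m\<close>; pairing the
  factors \<open>i\<close> and \<open>p-i\<close> of the factorials gives \<open>binomial(2p,p)^2 = 4 (1 - 4 p^2 (h(2) + p h(3)))\<close> and
  \<open>binomial(2m,m)^2 = 16^(p-1) (1 + p^2 (h(2) + p h(3)) / 2)\<close> modulo \<open>p^4\<close>.

  Thus \<open>T(p) = 4 (1 + p^2 a)\<close> and \<open>T(p-1) = 16^(p-1) (1 + p^2 b)\<close> modulo \<open>p^4\<close>, and \<open>a + b\<close> has to vanish
  modulo \<open>p^2\<close>. The harmonic sums in \<open>a + b\<close> cancel modulo \<open>p\<close>, because \<open>1/(m-s) = -2/(2s+1)\<close> modulo \<open>p\<close>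
  expresses \<open>H(m-i)\<close> by \<open>H(m)\<close>, \<open>H(2i-1)\<close> and \<open>H(i-1)\<close> (\<open>harmonic_half_minus\<close>). What remains is
  \<open>-(6 h(2) + 7 p h(3)) / 2\<close>, and this is \<open>0\<close> modulo \<open>p^2\<close> on comparing two evaluations of
  the sum of \<open>1/k^2\<close> over \<open>0 < k < p\<close>: pairing \<open>k\<close> with \<open>p-k\<close>, and splitting by the parity of \<open>k\<close>
  (\<open>half_power_sum_relation\<close>).
\<close>

section \<open>The recurrence and the telescoping sum\<close>

lemma of_nat_choose_absorb:
  "(of_nat (Suc k) :: rat) * of_nat (Suc n choose Suc k) = of_nat (Suc n) * of_nat (n choose k)"
  by (metis Suc_times_binomial of_nat_mult)

lemma of_nat_choose_absorb_comp:
  "((of_nat n :: rat) + 1 - of_nat k) * of_nat (Suc n choose k) = of_nat (Suc n) * of_nat (n choose k)"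
proof (cases "k \<le> n")
  case True
  have "(Suc n - k) * (Suc n choose k) = Suc n * (n choose k)"
    using binomial_absorb_comp[of "Suc n" k] by simp
  then have "(of_nat (Suc n - k) :: rat) * of_nat (Suc n choose k) = of_nat (Suc n) * of_nat (n choose k)"
    by (metis of_nat_mult)
  then show ?thesis using True by (simp add: of_nat_diff add.commute)
next
  case False
  then show ?thesis by (cases "k = Suc n") (auto simp: binomial_eq_0)
qed

lemma of_nat_choose_succ_lower:
  "((of_nat k :: rat) + 1) * of_nat (n choose Suc k) = (of_nat n - of_nat k) * of_nat (n choose k)"
proof (cases n)
  case 0
  then show ?thesis by (cases k) auto
next
  case (Suc m)
  then show ?thesis
    using of_nat_choose_absorb[of k m] of_nat_choose_absorb_comp[of m k]
    by (simp del: binomial_Suc_Suc add: add.commute)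
qed

definition summand :: "nat \<Rightarrow> nat \<Rightarrow> rat" where
  "summand n k = of_nat (n choose k) * of_nat ((2 * k) choose n)"

lemma T_eq_sum_summand: "of_nat (T n) = (\<Sum>k=0..n. (summand n k)\<^sup>2)"
  by (simp add: T_def summand_def power_mult_distrib)

text \<open>The product of this polynomial and \<open>(summand (n + 1) k)\<^sup>2\<close> is an
  antidifference in \<open>k\<close> of the recurrence operator applied to \<open>(summand n k)\<^sup>2\<close>. The polynomial
  is the quadratic solution of Gosper's equation, found by solving a linear system in its
  coefficients.\<close>

definition certificate :: "nat \<Rightarrow> nat \<Rightarrow> rat" where
  "certificate n k = 4 * (2 * of_nat n + 1) * of_nat k ^ 2
     - 8 * (of_nat n + 1) * (2 * of_nat n + 1) * of_nat k + (of_nat n + 1)\<^sup>2 * (7 * of_nat n + 3)"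

text \<open>The values of \<open>summand\<close> in the identity are polynomial multiples of the single quantity
  \<open>u = (n choose k) * ((2 * k + 1) choose n) / (2 * k + 1)\<close>, except that \<open>summand (n + 1) k\<close> must first be
  multiplied by \<open>n + 1 - k\<close>. Dividing \<open>u\<close> by this factor turns the claim into a polynomial identity.
  The only exception is \<open>k = n + 1\<close>, where the factor vanishes; there only \<open>summand (n + 1) (n + 1)\<close> is
  nonzero, and the certificate takes the value \<open>-(n + 1)^3\<close>.\<close>

lemma summand_certificate:
  assumes n: "n > 0" and k: "k \<le> Suc n"
  shows "(of_nat n + 1) ^ 3 * (summand (Suc n) k)\<^sup>2
      - 4 * (2 * of_nat n + 1) * (3 * of_nat n ^ 2 + 3 * of_nat n + 1) * (summand n k)\<^sup>2
      + 16 * of_nat n ^ 3 * (summand (n - 1) k)\<^sup>2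
    = certificate n (Suc k) * (summand (Suc n) (Suc k))\<^sup>2
      - certificate n k * (summand (Suc n) k)\<^sup>2"
proof (cases "k = Suc n")
  case True
  define N :: rat where "N = of_nat n"
  have "certificate n (Suc n) = - ((N + 1) ^ 3)"
    unfolding certificate_def of_nat_Suc N_def[symmetric]
    by (simp add: field_simps power2_eq_square power3_eq_cube)
  with True n show ?thesis
    by (simp add: summand_def binomial_eq_0 N_def)
next
  case False
  with k have kn: "k \<le> n" by simp
  define N K :: rat where "N = of_nat n" and "K = of_nat k"
  have K0: "2 * K + 1 \<noteq> 0" "K + 1 \<noteq> 0"
    unfolding K_def using of_nat_0_le_iff[of k, where 'a=rat] by linarith+
  have N0: "N \<noteq> 0" "N + 1 \<noteq> 0" "N + 1 - K \<noteq> 0"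
    using n kn unfolding N_def K_def by (simp_all flip: of_nat_Suc add: add_eq_0_iff)
  define b c where "b = (of_nat (n choose k) :: rat)" and "c = (of_nat ((2 * k + 1) choose n) :: rat)"
  define u where "u = b * c / (2 * K + 1)"
  have bc: "b * c = (2 * K + 1) * u"
    using K0 by (simp add: u_def)
  have c1: "of_nat ((2 * k) choose n) * (2 * K + 1) = (2 * K + 1 - N) * c"
    using of_nat_choose_absorb_comp[of "2 * k" n] by (simp add: K_def N_def c_def algebra_simps)
  have f0: "summand n k = (2 * K + 1 - N) * u"
  proof -
    have "(2 * K + 1) * summand n k = b * (of_nat ((2 * k) choose n) * (2 * K + 1))"
      unfolding summand_def b_def by (simp only: ac_simps)
    also have "\<dots> = (2 * K + 1 - N) * (b * c)"
      unfolding c1 by (simp only: ac_simps)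
    also have "\<dots> = (2 * K + 1) * ((2 * K + 1 - N) * u)"
      unfolding bc by (simp only: ac_simps)
    finally show ?thesis using K0 by simp
  qed
  have f1: "summand (Suc n) (Suc k) = 2 * (2 * K + 1) * u"
  proof -
    have 1: "(K + 1) * of_nat (Suc n choose Suc k) = (N + 1) * b"
      using of_nat_choose_absorb[of k n] by (simp add: K_def N_def b_def algebra_simps)
    have 2: "(N + 1) * of_nat ((2 * Suc k) choose Suc n) = 2 * (K + 1) * c"
      using of_nat_choose_absorb[of n "2 * k + 1"] by (simp add: K_def N_def c_def algebra_simps)
    have "((K + 1) * (N + 1)) * summand (Suc n) (Suc k)
        = ((K + 1) * of_nat (Suc n choose Suc k)) * ((N + 1) * of_nat ((2 * Suc k) choose Suc n))"
      unfolding summand_def by (simp only: ac_simps)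
    also have "\<dots> = ((K + 1) * (N + 1)) * (2 * (b * c))"
      unfolding 1 2 by (simp only: ac_simps)
    finally show ?thesis using K0 N0 bc by simp
  qed
  have fm: "summand (n - 1) k = (N - K) * u"
  proof -
    obtain l where l: "n = Suc l" using n by (cases n) auto
    have 1: "N * of_nat ((n - 1) choose k) = (N - K) * b"
      using of_nat_choose_absorb_comp[of l k] by (simp add: K_def N_def b_def l algebra_simps)
    have 2: "(2 * K + 1) * of_nat ((2 * k) choose (n - 1)) = N * c"
      using of_nat_choose_absorb[of l "2 * k"] by (simp add: K_def N_def c_def l algebra_simps)
    have "(N * (2 * K + 1)) * summand (n - 1) k
        = (N * of_nat ((n - 1) choose k)) * ((2 * K + 1) * of_nat ((2 * k) choose (n - 1)))"
      unfolding summand_def by (simp only: ac_simps)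
    also have "\<dots> = (N * (N - K)) * (b * c)"
      unfolding 1 2 by (simp only: ac_simps)
    also have "\<dots> = (N * (2 * K + 1)) * ((N - K) * u)"
      unfolding bc by (simp only: ac_simps)
    finally show ?thesis using K0 N0 by simp
  qed
  have fp: "(N + 1 - K) * summand (Suc n) k = (2 * K - N) * (2 * K + 1 - N) * u"
  proof -
    have 1: "(N + 1 - K) * of_nat (Suc n choose k) = (N + 1) * b"
      using of_nat_choose_absorb_comp[of n k] by (simp add: K_def N_def b_def algebra_simps)
    have 2: "(N + 1) * of_nat ((2 * k) choose Suc n) = (2 * K - N) * of_nat ((2 * k) choose n)"
      using of_nat_choose_succ_lower[of n "2 * k"] by (simp add: K_def N_def)
    have "(N + 1) * ((N + 1 - K) * summand (Suc n) k)
        = ((N + 1 - K) * of_nat (Suc n choose k)) * ((N + 1) * of_nat ((2 * k) choose Suc n))"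
      unfolding summand_def by (simp only: ac_simps)
    also have "\<dots> = (N + 1) * ((2 * K - N) * summand n k)"
      unfolding 1 2 summand_def b_def by (simp only: ac_simps)
    finally show ?thesis using N0 f0 by simp
  qed
  define w where "w = u / (N + 1 - K)"
  have u_eq: "u = (N + 1 - K) * w" using N0 by (simp add: w_def)
  have f2: "summand (Suc n) k = (2 * K - N) * (2 * K + 1 - N) * w"
    using fp N0 by (simp add: w_def field_simps)
  show ?thesis
    unfolding certificate_def of_nat_Suc N_def[symmetric] K_def[symmetric] f0 f1 fm f2 u_eq
    by (simp add: algebra_simps eval_nat_numeral)
qed

text \<open>Summing the certificate identity over \<open>k \<le> n + 1\<close> leaves no boundary terms, since
  \<open>summand (n + 1) k\<close> vanishes at \<open>k = 0\<close> and at \<open>k = n + 2\<close>. For \<open>n = 0\<close> the last term has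
  coefficient \<open>0\<close>, so the truncated index \<open>n - 1\<close> does no harm.\<close>

lemma T_recurrence:
  "(of_nat n + 1) ^ 3 * (of_nat (T (Suc n)) :: rat)
    = 4 * (2 * of_nat n + 1) * (3 * of_nat n ^ 2 + 3 * of_nat n + 1) * of_nat (T n)
      - 16 * of_nat n ^ 3 * of_nat (T (n - 1))"
proof (cases "n = 0")
  case True
  then show ?thesis by (simp add: T_def)
next
  case False
  then have n: "n > 0" by simp
  have ext: "of_nat (T j) = (\<Sum>k=0..Suc n. (summand j k)\<^sup>2)" if "j \<le> Suc n" for j
    unfolding T_eq_sum_summand
    by (rule sum.mono_neutral_left) (use that in \<open>auto simp: summand_def binomial_eq_0\<close>)
  define q where "q = 4 * (2 * of_nat n + 1) * (3 * of_nat n ^ 2 + 3 * of_nat n + (1::rat))"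
  have "(of_nat n + 1) ^ 3 * (of_nat (T (Suc n)) :: rat) - q * of_nat (T n)
      + 16 * of_nat n ^ 3 * of_nat (T (n - 1))
    = (\<Sum>k=0..Suc n. (of_nat n + 1) ^ 3 * (summand (Suc n) k)\<^sup>2 - q * (summand n k)\<^sup>2
        + 16 * of_nat n ^ 3 * (summand (n - 1) k)\<^sup>2)"
    by (simp only: ext[of "Suc n"] ext[of n] ext[of "n - 1"] sum_distrib_left sum.distrib
        sum_subtractf order_refl le_SucI diff_le_self)
  also have "\<dots> = (\<Sum>k=0..Suc n. certificate n (Suc k) * (summand (Suc n) (Suc k))\<^sup>2
      - certificate n k * (summand (Suc n) k)\<^sup>2)"
    unfolding q_def by (intro sum.cong refl summand_certificate n) simp
  also have "\<dots> = certificate n (Suc (Suc n)) * (summand (Suc n) (Suc (Suc n)))\<^sup>2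
      - certificate n 0 * (summand (Suc n) 0)\<^sup>2"
    by (rule sum_Suc_diff) simp
  also have "\<dots> = 0"
    by (simp add: summand_def binomial_eq_0)
  finally show ?thesis by (simp add: q_def)
qed

text \<open>With \<open>w = (N+1)^3 T(N+1)\<close> the numerator at \<open>N + 1\<close> is \<open>-2\<close> times a quadratic form in \<open>w\<close> and \<open>T(N)\<close>.
  Replacing \<open>w\<close> by means of the recurrence reproduces the old terms in \<open>T(N-1)^2\<close> and \<open>T(N) T(N-1)\<close>:
  the coefficient \<open>-8(3N^3-2N)\<close> of the mixed term \<open>N^3 T(N) T(N-1)\<close> is chosen such that its values at \<open>N\<close> and \<open>N + 1\<close>
  add up to \<open>-8(2N+1)(3N^2+3N+1)\<close>. The increment is therefore a multiple of \<open>T(N)^2\<close> alone.\<close>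

lemma weighted_sum_T_squared:
  fixes N :: nat
  shows "(\<Sum>n<N. (3 * (2 * of_nat n + 1) ^ 5 - 2 * (2 * of_nat n + 1) ^ 3 - (2 * of_nat n + 1))
        * ((of_nat (T n))\<^sup>2 / 16 ^ n))
    = - 2 * (of_nat N ^ 6 * ((of_nat (T N))\<^sup>2 + 16 * (of_nat (T (N - 1)))\<^sup>2)
        - 8 * of_nat N ^ 4 * (3 * of_nat N ^ 2 - 2) * of_nat (T N) * of_nat (T (N - 1)))
      / (16 ^ N :: rat)"
proof (induction N)
  case 0
  then show ?case by simp
next
  case (Suc N)
  define x where "x = (of_nat N :: rat)"
  define t s r where "t = (of_nat (T N) :: rat)" and "s = (of_nat (T (N - 1)) :: rat)"
    and "r = (of_nat (T (Suc N)) :: rat)"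
  have Suc_x: "of_nat (Suc N) = x + 1" by (simp add: x_def)
  have rec: "(x + 1) ^ 3 * r = 4 * (2 * x + 1) * (3 * x ^ 2 + 3 * x + 1) * t - 16 * x ^ 3 * s"
    unfolding x_def t_def s_def r_def by (rule T_recurrence)
  have "16 * (3 * (2 * x + 1) ^ 5 - 2 * (2 * x + 1) ^ 3 - (2 * x + 1)) * t\<^sup>2
      - 32 * (x ^ 6 * (t\<^sup>2 + 16 * s\<^sup>2) - 8 * x ^ 4 * (3 * x ^ 2 - 2) * t * s)
    = - 2 * (((x + 1) ^ 3 * r)\<^sup>2 + 16 * (x + 1) ^ 6 * t\<^sup>2
        - 8 * (x + 1) * (3 * (x + 1) ^ 2 - 2) * ((x + 1) ^ 3 * r) * t)"
    unfolding rec by (simp add: algebra_simps eval_nat_numeral)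
  also have "\<dots> = - 2 * ((x + 1) ^ 6 * (r\<^sup>2 + 16 * t\<^sup>2)
        - 8 * (x + 1) ^ 4 * (3 * (x + 1) ^ 2 - 2) * r * t)"
    by (simp add: algebra_simps eval_nat_numeral)
  finally have step: "16 * (3 * (2 * x + 1) ^ 5 - 2 * (2 * x + 1) ^ 3 - (2 * x + 1)) * t\<^sup>2
      - 32 * (x ^ 6 * (t\<^sup>2 + 16 * s\<^sup>2) - 8 * x ^ 4 * (3 * x ^ 2 - 2) * t * s)
    = - 2 * ((x + 1) ^ 6 * (r\<^sup>2 + 16 * t\<^sup>2)
        - 8 * (x + 1) ^ 4 * (3 * (x + 1) ^ 2 - 2) * r * t)" .
  have comb: "- 2 * a / c + w * (b / c) = d / (16 * c)" if "16 * w * b - 32 * a = d" "c \<noteq> 0"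
    for a b c d w :: rat
    unfolding that(1)[symmetric] using that(2) by (simp add: field_simps)
  show ?case
    unfolding sum.lessThan_Suc Suc.IH diff_Suc_1 Suc_x power_Suc[of 16]
      x_def[symmetric] t_def[symmetric] s_def[symmetric] r_def[symmetric]
    by (rule comb[OF step]) simp
qed

section \<open>Congruences between rationals that are integral at a prime\<close>

text \<open>Closure properties are easier to see for arbitrary fractions than for reduced ones.\<close>

lemma denom_prime_to_iff_fraction:
  "denom_prime_to p x \<longleftrightarrow> (\<exists>a b. coprime b (int p) \<and> b \<noteq> 0 \<and> x = of_int a / of_int b)"
proof
  assume "denom_prime_to p x"
  moreover obtain n d where nd: "quotient_of x = (n, d)" by fastforce
  ultimately show "\<exists>a b. coprime b (int p) \<and> b \<noteq> 0 \<and> x = of_int a / of_int b"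
    using quotient_of_div[OF nd] quotient_of_denom_pos[OF nd]
    by (intro exI[of _ n] exI[of _ d]) (auto simp: denom_prime_to_def)
next
  assume "\<exists>a b. coprime b (int p) \<and> b \<noteq> 0 \<and> x = of_int a / of_int b"
  then obtain a b where ab: "coprime b (int p)" "b \<noteq> 0" "x = of_int a / of_int b" by blast
  obtain n d where nd: "quotient_of x = (n, d)" by fastforce
  have d: "d > 0" and cop: "coprime n d" and x: "x = of_int n / of_int d"
    using quotient_of_div[OF nd] quotient_of_denom_pos[OF nd] quotient_of_coprime[OF nd] by auto
  have "(of_int (n * b) :: rat) = of_int (a * d)"
    using x ab d by (simp add: field_simps)
  then have "n * b = a * d" by (simp only: of_int_eq_iff)
  then have "d dvd n * b" by simp
  then have "d dvd b" using cop by (simp add: coprime_commute coprime_dvd_mult_right_iff)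
  then have "coprime d (int p)" using ab(1) by (meson coprime_divisors dvd_refl)
  then show "denom_prime_to p x" using nd by (simp add: denom_prime_to_def)
qed

locale prime_congruence =
  fixes p :: nat
  assumes prime: "prime p"
begin

abbreviation integral :: "rat \<Rightarrow> bool" where
  "integral \<equiv> denom_prime_to p"

abbreviation cong_pow :: "rat \<Rightarrow> nat \<Rightarrow> rat \<Rightarrow> bool" ("(_ \<approx>\<^bsub>_\<^esub> _)" [51, 0, 51] 50) where
  "x \<approx>\<^bsub>n\<^esub> y \<equiv> rat_cong p n x y"

abbreviation P :: rat where "P \<equiv> of_nat p"

lemma P_nonzero [simp]: "P \<noteq> 0"
  using prime prime_gt_0_nat by fastforce

lemma integral_of_int [simp]: "integral (of_int a)"
  unfolding denom_prime_to_iff_fraction by (intro exI[of _ a] exI[of _ 1]) simp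

lemma integral_of_nat [simp]: "integral (of_nat a)"
  using integral_of_int[of "int a"] by simp

lemma integral_numeral [simp]: "integral (numeral a)" "integral 0" "integral 1"
  using integral_of_int[of "numeral a"] integral_of_int[of 0] integral_of_int[of 1] by simp_all

lemma integral_mult [simp]: "integral x \<Longrightarrow> integral y \<Longrightarrow> integral (x * y)"
proof -
  assume "integral x" "integral y"
  then obtain a b c d where "coprime b (int p)" "b \<noteq> 0" "x = of_int a / of_int b"
    "coprime d (int p)" "d \<noteq> 0" "y = of_int c / of_int d"
    unfolding denom_prime_to_iff_fraction by blast
  then show ?thesis unfolding denom_prime_to_iff_fraction
    by (intro exI[of _ "a * c"] exI[of _ "b * d"]) simp
qed

lemma integral_add [simp]: "integral x \<Longrightarrow> integral y \<Longrightarrow> integral (x + y)"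
proof -
  assume "integral x" "integral y"
  then obtain a b c d where "coprime b (int p)" "b \<noteq> 0" "x = of_int a / of_int b"
    "coprime d (int p)" "d \<noteq> 0" "y = of_int c / of_int d"
    unfolding denom_prime_to_iff_fraction by blast
  then show ?thesis unfolding denom_prime_to_iff_fraction
    by (intro exI[of _ "a * d + c * b"] exI[of _ "b * d"]) (simp add: field_simps)
qed

lemma integral_uminus [simp]: "integral x \<Longrightarrow> integral (- x)"
  using integral_mult[of "of_int (- 1)" x] integral_of_int[of "- 1"] by simp

lemma integral_diff [simp]: "integral x \<Longrightarrow> integral y \<Longrightarrow> integral (x - y)"
  using integral_add[of x "- y"] by simp

lemma integral_power [simp]: "integral x \<Longrightarrow> integral (x ^ n)"
  by (induction n) simp_all

lemma integral_sum [simp]: "(\<And>i. i \<in> A \<Longrightarrow> integral (f i)) \<Longrightarrow> integral (sum f A)"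
  by (induction A rule: infinite_finite_induct) simp_all

definition invertible :: "rat \<Rightarrow> bool" where
  "invertible x \<longleftrightarrow> integral (inverse x)"

lemma integral_divide [simp]: "integral x \<Longrightarrow> invertible y \<Longrightarrow> integral (x / y)"
  by (simp add: invertible_def divide_inverse)

lemma invertible_mult [simp]: "invertible x \<Longrightarrow> invertible y \<Longrightarrow> invertible (x * y)"
  and invertible_power [simp]: "invertible x \<Longrightarrow> invertible (x ^ n)"
  by (simp_all add: invertible_def flip: power_inverse)

lemma invertible_of_nat:
  assumes "\<not> p dvd k"
  shows "invertible (of_nat k)"
proof -
  have "coprime (int k) (int p)"
    using assms prime by (metis coprime_commute coprime_int_iff prime_imp_coprime)
  moreover have "k \<noteq> 0" using assms by (intro notI) simp
  ultimately show ?thesis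
    unfolding denom_prime_to_iff_fraction invertible_def
    by (intro exI[of _ 1] exI[of _ "int k"]) (simp add: inverse_eq_divide)
qed

text \<open>The relation of the theorem contains the integrality of both sides, so it is a congruence
  relation on the ring of \<open>p\<close>-integral rationals.\<close>

lemma rcong_iff:
  "x \<approx>\<^bsub>n\<^esub> y \<longleftrightarrow> integral x \<and> integral y \<and> (\<exists>z. integral z \<and> x - y = P ^ n * z)"
proof -
  have "integral ((x - y) / P ^ n) \<longleftrightarrow> (\<exists>z. integral z \<and> x - y = P ^ n * z)"
    by (metis P_nonzero nonzero_mult_div_cancel_left power_not_zero times_divide_eq_right)
  then show ?thesis by (simp add: rat_cong_def)
qed

lemma rcongI: "integral y \<Longrightarrow> integral z \<Longrightarrow> x - y = P ^ n * z \<Longrightarrow> x \<approx>\<^bsub>n\<^esub> y"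
  unfolding rcong_iff by (metis add_diff_cancel_left' diff_add_cancel integral_add integral_mult
      integral_power integral_of_nat)

lemma rcong_refl [simp]: "integral x \<Longrightarrow> x \<approx>\<^bsub>n\<^esub> x"
  by (rule rcongI[where z = 0]) simp_all

lemma rcong_sym: "x \<approx>\<^bsub>n\<^esub> y \<Longrightarrow> y \<approx>\<^bsub>n\<^esub> x"
  unfolding rcong_iff by (metis integral_uminus minus_diff_eq mult_minus_right)

lemma rcong_add: "x \<approx>\<^bsub>n\<^esub> y \<Longrightarrow> x' \<approx>\<^bsub>n\<^esub> y' \<Longrightarrow> x + x' \<approx>\<^bsub>n\<^esub> y + y'"
proof -
  assume "x \<approx>\<^bsub>n\<^esub> y" "x' \<approx>\<^bsub>n\<^esub> y'"
  then obtain z z' where "integral z" "x - y = P ^ n * z" "integral z'" "x' - y' = P ^ n * z'"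
    "integral y" "integral y'"
    unfolding rcong_iff by blast
  then show ?thesis by (intro rcongI[where z = "z + z'"]) (simp_all add: algebra_simps)
qed

lemma rcong_trans [trans]: "x \<approx>\<^bsub>n\<^esub> y \<Longrightarrow> y \<approx>\<^bsub>n\<^esub> z \<Longrightarrow> x \<approx>\<^bsub>n\<^esub> z"
  using rcong_add[of n x y y z] by (auto simp: rcong_iff)

lemma rcong_mult: "x \<approx>\<^bsub>n\<^esub> y \<Longrightarrow> x' \<approx>\<^bsub>n\<^esub> y' \<Longrightarrow> x * x' \<approx>\<^bsub>n\<^esub> y * y'"
proof -
  assume "x \<approx>\<^bsub>n\<^esub> y" "x' \<approx>\<^bsub>n\<^esub> y'"
  then obtain z z' where z: "integral z" "x - y = P ^ n * z" "integral z'" "x' - y' = P ^ n * z'"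
    and i: "integral y" "integral y'" "integral x'"
    unfolding rcong_iff by blast
  have "x * x' - y * y' = (x - y) * x' + y * (x' - y')" by (simp add: algebra_simps)
  also have "\<dots> = P ^ n * (z * x' + y * z')" unfolding z by (simp add: algebra_simps)
  finally show ?thesis using z i by (intro rcongI[where z = "z * x' + y * z'"]) simp_all
qed

lemma rcong_scale: "integral c \<Longrightarrow> x \<approx>\<^bsub>n\<^esub> y \<Longrightarrow> c * x \<approx>\<^bsub>n\<^esub> c * y"
  by (simp add: rcong_mult)

lemma rcong_diff: "x \<approx>\<^bsub>n\<^esub> y \<Longrightarrow> x' \<approx>\<^bsub>n\<^esub> y' \<Longrightarrow> x - x' \<approx>\<^bsub>n\<^esub> y - y'"
  using rcong_add[of n x y "- x'" "- y'"] rcong_scale[of "- 1" n x' y'] by simp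

lemma rcong_power: "x \<approx>\<^bsub>n\<^esub> y \<Longrightarrow> x ^ k \<approx>\<^bsub>n\<^esub> y ^ k"
  by (induction k) (simp_all add: rcong_mult)

lemma rcong_sum: "(\<And>i. i \<in> A \<Longrightarrow> f i \<approx>\<^bsub>n\<^esub> g i) \<Longrightarrow> sum f A \<approx>\<^bsub>n\<^esub> sum g A"
  by (induction A rule: infinite_finite_induct) (simp_all add: rcong_add)

lemma rcong_prod: "(\<And>i. i \<in> A \<Longrightarrow> f i \<approx>\<^bsub>n\<^esub> g i) \<Longrightarrow> prod f A \<approx>\<^bsub>n\<^esub> prod g A"
  by (induction A rule: infinite_finite_induct) (simp_all add: rcong_mult)

lemma rcong_mult_P_power:
  assumes "x \<approx>\<^bsub>n\<^esub> y" "l = k + n" shows "P ^ k * x \<approx>\<^bsub>l\<^esub> P ^ k * y"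
proof -
  obtain z where "integral y" "integral z" "x - y = P ^ n * z"
    using assms(1) unfolding rcong_iff by blast
  then show ?thesis unfolding assms(2)
    by (intro rcongI[where z = z]) (simp_all add: power_add flip: right_diff_distrib)
qed

lemma rcong_le: "x \<approx>\<^bsub>n\<^esub> y \<Longrightarrow> k \<le> n \<Longrightarrow> x \<approx>\<^bsub>k\<^esub> y"
proof -
  assume "x \<approx>\<^bsub>n\<^esub> y" and k: "k \<le> n"
  then obtain z where "integral y" "integral z" "x - y = P ^ n * z"
    unfolding rcong_iff by blast
  moreover have "P ^ n = P ^ k * P ^ (n - k)" using k by (simp flip: power_add)
  ultimately show ?thesis by (intro rcongI[where z = "P ^ (n - k) * z"]) simp_all
qed

lemma rcong_P_power_0: "integral z \<Longrightarrow> n \<le> k \<Longrightarrow> P ^ k * z \<approx>\<^bsub>n\<^esub> 0"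
  by (rule rcong_le[of k], rule rcongI[where z = z]) simp_all

text \<open>Each product of two of the small terms is divisible by \<open>p^(2k)\<close>. This linearisation stands in
  for taking logarithms.\<close>

lemma prod_one_plus_rcong:
  assumes "\<And>i. i \<in> A \<Longrightarrow> integral (a i)" and n: "n = 2 * k"
  shows "(\<Prod>i\<in>A. 1 + P ^ k * a i) \<approx>\<^bsub>n\<^esub> 1 + P ^ k * (\<Sum>i\<in>A. a i)"
  unfolding n using assms(1)
proof (induction A rule: infinite_finite_induct)
  case (insert x A)
  then have ints: "integral (a x)" "integral (\<Sum>i\<in>A. a i)" by simp_all
  have "(\<Prod>i\<in>insert x A. 1 + P ^ k * a i) = (1 + P ^ k * a x) * (\<Prod>i\<in>A. 1 + P ^ k * a i)"
    using insert by simp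
  also have "\<dots> \<approx>\<^bsub>2 * k\<^esub> (1 + P ^ k * a x) * (1 + P ^ k * (\<Sum>i\<in>A. a i))"
    using insert by (intro rcong_scale) simp_all
  also have "\<dots> \<approx>\<^bsub>2 * k\<^esub> 1 + P ^ k * (\<Sum>i\<in>insert x A. a i)"
    using insert ints by (intro rcongI[where z = "a x * (\<Sum>i\<in>A. a i)"])
      (simp_all add: algebra_simps power_mult power2_eq_square flip: mult_2_right)
  finally show ?case .
qed simp_all

lemma square_one_plus_rcong:
  assumes "x \<approx>\<^bsub>n\<^esub> 1 + P ^ k * a" "integral a" and n: "n = 2 * k"
  shows "x\<^sup>2 \<approx>\<^bsub>n\<^esub> 1 + 2 * P ^ k * a"
proof -
  have "x\<^sup>2 \<approx>\<^bsub>n\<^esub> (1 + P ^ k * a)\<^sup>2" by (rule rcong_power[OF assms(1)])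
  also have "\<dots> \<approx>\<^bsub>n\<^esub> 1 + 2 * P ^ k * a"
    unfolding n using assms(2) by (intro rcongI[where z = "a\<^sup>2"])
      (simp_all add: algebra_simps power2_eq_square power_mult)
  finally show ?thesis .
qed

end

section \<open>Harmonic sums\<close>

text \<open>The two rearrangements of the indices below an odd number \<open>2m+1\<close>: into the pairs \<open>i\<close>, \<open>2m+1-i\<close>, and
  into the even numbers and their odd complements. They are needed for sums and for products.\<close>

lemma (in comm_monoid_set) reflect_halves:
  "F g {1..2 * m} = F (\<lambda>i. g i \<^bold>* g (2 * m + 1 - i)) {1..m}" for m :: nat
proof -
  have "{1..2 * m} = {1..m} \<union> {m + 1..2 * m}" by auto
  then have "F g {1..2 * m} = F g {1..m} \<^bold>* F g {m + 1..2 * m}"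
    by (simp add: union_disjoint)
  also have "F g {m + 1..2 * m} = F (\<lambda>i. g (2 * m + 1 - i)) {1..m}"
    by (rule reindex_bij_witness[of _ "\<lambda>i. 2 * m + 1 - i" "\<lambda>i. 2 * m + 1 - i"]) auto
  finally show ?thesis by (simp add: distrib)
qed

lemma (in comm_monoid_set) reflect_odd:
  "F g {1..2 * m} = F (\<lambda>i. g (2 * i) \<^bold>* g (2 * m + 1 - 2 * i)) {1..m}" for m :: nat
proof -
  have "{1..2 * m} = {k \<in> {1..2 * m}. even k} \<union> {k \<in> {1..2 * m}. odd k}" by auto
  then have "F g {1..2 * m} = F g {k \<in> {1..2 * m}. even k} \<^bold>* F g {k \<in> {1..2 * m}. odd k}"
    by (metis (no_types, lifting) disjoint_iff finite_Un finite_atLeastAtMost mem_Collect_eq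
        union_disjoint)
  also have "F g {k \<in> {1..2 * m}. even k} = F (\<lambda>i. g (2 * i)) {1..m}"
    by (rule reindex_bij_witness[of _ "\<lambda>i. 2 * i" "\<lambda>k. k div 2"]) auto
  also have "F g {k \<in> {1..2 * m}. odd k} = F (\<lambda>i. g (2 * m + 1 - 2 * i)) {1..m}"
    by (rule reindex_bij_witness[of _ "\<lambda>i. 2 * m + 1 - 2 * i" "\<lambda>k. (2 * m + 1 - k) div 2"])
      (auto elim!: oddE simp flip: diff_mult_distrib2)
  finally show ?thesis by (simp add: distrib)
qed

definition harmonic :: "nat \<Rightarrow> rat" where
  "harmonic n = (\<Sum>i=1..n. 1 / of_nat i)"

lemma harmonic_0 [simp]: "harmonic 0 = 0"
  and harmonic_Suc: "harmonic (Suc n) = harmonic n + 1 / of_nat (Suc n)"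
  by (simp_all add: harmonic_def)

lemma choose_add_eq_prod:
  "(of_nat ((n + j) choose j) :: rat) = (\<Prod>l=1..j. 1 + of_nat n / of_nat l)"
proof (induction j)
  case (Suc j)
  have "(of_nat (Suc j) :: rat) * of_nat ((n + Suc j) choose Suc j)
      = of_nat (Suc j) * ((\<Prod>l=1..j. 1 + of_nat n / of_nat l) * (1 + of_nat n / of_nat (Suc j)))"
  proof -
    have "of_nat (Suc j) * (1 + of_nat n / of_nat (Suc j)) = (of_nat (Suc (n + j)) :: rat)"
      by (simp add: distrib_left del: of_nat_Suc)
    then show ?thesis
      using of_nat_choose_absorb[of j "n + j"] Suc.IH
      by (simp del: binomial_Suc_Suc of_nat_Suc add: mult.left_commute mult.commute)
  qed
  then show ?case
    by (simp del: binomial_Suc_Suc of_nat_Suc)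
qed simp

lemma choose_eq_prod:
  "(of_nat (n choose j) :: rat) = (\<Prod>l=1..j. (of_nat n + 1) / of_nat l - 1)"
proof (induction j)
  case (Suc j)
  define q where "q = (\<Prod>l=1..j. (of_nat n + 1) / of_nat l - (1::rat))"
  define x where "x = (of_nat n + 1) / of_nat (Suc j) - (1::rat)"
  have x: "of_nat (Suc j) * x = of_nat n - of_nat j"
    unfolding x_def by (simp add: right_diff_distrib del: of_nat_Suc)
  have "(of_nat (Suc j) :: rat) * of_nat (n choose Suc j) = (of_nat n - of_nat j) * q"
    using of_nat_choose_succ_lower[of j n] Suc.IH by (simp add: q_def add.commute)
  also have "\<dots> = of_nat (Suc j) * (q * x)"
    unfolding x[symmetric] by (simp only: ac_simps)
  finally have "of_nat (n choose Suc j) = q * x"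
    by (simp del: of_nat_Suc)
  then show ?case by (simp add: q_def x_def)
qed simp

locale prime_above_3 = prime_congruence +
  fixes m :: nat
  assumes p_eq: "2 * m + 1 = p" and above_3: "p > 3"
begin

lemma p_minus_1: "p - 1 = 2 * m"
  by (simp flip: p_eq)

lemma invertible_less [simp]: "0 < k \<Longrightarrow> k < p \<Longrightarrow> invertible (of_nat k)"
  by (rule invertible_of_nat) (auto dest: dvd_imp_le)

lemma invertible_small [simp]: "invertible 2" "invertible 3" "invertible 4" "invertible 6" "invertible 16"
proof -
  show two: "invertible 2" and three: "invertible 3"
    using invertible_less[of 2] invertible_less[of 3] above_3 by simp_all
  show "invertible 4" "invertible 6" "invertible 16"
    using invertible_power[OF two, of 2] invertible_mult[OF two three] invertible_power[OF two, of 4]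
    by simp_all
qed

lemma integral_inverse: "0 < k \<Longrightarrow> k < p \<Longrightarrow> integral (1 / of_nat k)"
  by simp

lemma of_nat_p_minus: "k \<le> p \<Longrightarrow> of_nat (p - k) = P - of_nat k"
  by (simp add: of_nat_diff)

lemma P_minus_nonzero: "k < p \<Longrightarrow> P - of_nat k \<noteq> 0"
  by simp

lemma integral_harmonic [simp]: "n < p \<Longrightarrow> integral (harmonic n)"
  unfolding harmonic_def by (intro integral_sum integral_inverse) auto

lemma inverse_reflect:
  assumes "0 < k" "k < p"
  shows "1 / of_nat (p - k) \<approx>\<^bsub>1\<^esub> - (1 / of_nat k)"
proof (rule rcongI)
  show "integral ((1 / of_nat (p - k)) * (1 / of_nat k))"
    using assms by (intro integral_mult integral_inverse) auto
  show "1 / of_nat (p - k) - (- (1 / of_nat k)) = P ^ 1 * ((1 / of_nat (p - k)) * (1 / of_nat k))"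
    using assms P_minus_nonzero[of k] by (simp add: of_nat_p_minus field_simps)
qed (use assms in simp)

lemma inverse_square_reflect:
  assumes "0 < k" "k < p"
  shows "1 / of_nat (p - k) ^ 2 \<approx>\<^bsub>2\<^esub> 1 / of_nat k ^ 2 + 2 * P * (1 / of_nat k ^ 3)"
proof -
  define K L where "K = (of_nat k :: rat)" and "L = P - K"
  have nz: "K \<noteq> 0" "L \<noteq> 0" and L: "of_nat (p - k) = L" and P: "P = K + L"
    using assms by (auto simp: K_def L_def of_nat_p_minus)
  have ints: "integral K" "invertible K" "invertible L"
    using assms invertible_less[of k] invertible_less[of "p - k"] L K_def by simp_all
  have "1 / L ^ 2 - (1 / K ^ 2 + 2 * P * (1 / K ^ 3)) = P ^ 2 * ((3 * K - 2 * P) * (1 / K ^ 3) * (1 / L ^ 2))"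
    unfolding P using nz
    by (simp add: divide_simps) (simp add: algebra_simps eval_nat_numeral)
  then show ?thesis
    unfolding L K_def[symmetric] using ints
    by (intro rcongI[where z = "(3 * K - 2 * P) * (1 / K ^ 3) * (1 / L ^ 2)"]) simp_all
qed

lemma harmonic_pred_prime: "harmonic (p - 1) \<approx>\<^bsub>1\<^esub> 0"
proof -
  have "harmonic (p - 1) = (\<Sum>i=1..m. 1 / of_nat i + 1 / of_nat (p - i))"
    unfolding harmonic_def p_minus_1 sum.reflect_halves p_eq ..
  also have "\<dots> \<approx>\<^bsub>1\<^esub> (\<Sum>i=1..m. 1 / of_nat i + - (1 / of_nat i))"
    using p_eq by (intro rcong_sum rcong_add rcong_refl inverse_reflect integral_inverse) auto
  finally show ?thesis by simp
qed

lemma harmonic_reflect: "j < p \<Longrightarrow> harmonic (p - 1 - j) \<approx>\<^bsub>1\<^esub> harmonic j"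
proof (induction j)
  case 0
  then show ?case using harmonic_pred_prime by simp
next
  case (Suc j)
  have eq: "p - 1 - j = Suc (p - 1 - Suc j)" using Suc.prems by simp
  have "harmonic (p - 1 - Suc j) = harmonic (p - 1 - j) - 1 / of_nat (p - Suc j)"
    unfolding eq harmonic_Suc using Suc.prems by simp
  also have "\<dots> \<approx>\<^bsub>1\<^esub> harmonic j - (- (1 / of_nat (Suc j)))"
    using Suc by (intro rcong_diff inverse_reflect) simp_all
  finally show ?case by (simp add: harmonic_Suc)
qed

text \<open>By induction on \<open>i\<close>: the step removes \<open>1/(m-i)\<close> on the left, and
  \<open>1/(m-i) = 2/(p-(2i+1)) = -2/(2i+1)\<close> modulo \<open>p\<close>, while the right-hand side gains
  \<open>2/(2i) + 2/(2i+1) - 1/i\<close>. At \<open>i = 0\<close> the truncated indices denote empty sums, as required.\<close>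

lemma harmonic_half_minus:
  "i \<le> m \<Longrightarrow> harmonic (m - i) \<approx>\<^bsub>1\<^esub> harmonic m + 2 * harmonic (2 * i - 1) - harmonic (i - 1)"
proof (induction i)
  case 0
  then show ?case using p_eq by simp
next
  case (Suc i)
  have eq: "m - i = Suc (m - Suc i)" using Suc.prems by auto
  have lt: "2 * i + 1 < p" using Suc.prems p_eq by auto
  have dbl: "2 * (m - i) = p - (2 * i + 1)" using p_eq by simp
  have "harmonic (m - i) = harmonic (m - Suc i) + 1 / of_nat (m - i)"
    unfolding eq harmonic_Suc ..
  then have "harmonic (m - Suc i) = harmonic (m - i) - 2 * (1 / of_nat (2 * (m - i)))"
    by simp
  also have "\<dots> \<approx>\<^bsub>1\<^esub> (harmonic m + 2 * harmonic (2 * i - 1) - harmonic (i - 1))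
      - 2 * (- (1 / of_nat (2 * i + 1)))"
    unfolding dbl using Suc lt
    by (intro rcong_diff[OF _ rcong_scale] inverse_reflect) auto
  also have "\<dots> = harmonic m + 2 * harmonic (2 * Suc i - 1) - harmonic (Suc i - 1)"
  proof (cases i)
    case 0
    then show ?thesis by (simp add: harmonic_Suc)
  next
    case (Suc j)
    have "2 * Suc i - 1 = Suc (Suc (2 * i - 1))" "2 * i = Suc (2 * i - 1)"
      using Suc by simp_all
    moreover have "Suc (i - 1) = i" using Suc by simp
    ultimately have 1: "harmonic (2 * Suc i - 1) = harmonic (2 * i - 1) + 1 / (2 * of_nat i) + 1 / of_nat (2 * i + 1)"
      using harmonic_Suc[of "2 * i - 1"] harmonic_Suc[of "2 * i"] by simp
    have 2: "harmonic i = harmonic (i - 1) + 1 / of_nat i"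
      using Suc by (simp add: harmonic_Suc)
    show ?thesis unfolding 1 diff_Suc_1 2 by (simp add: algebra_simps)
  qed
  finally show ?case .
qed

definition half_power_sum :: "nat \<Rightarrow> rat" where
  "half_power_sum s = (\<Sum>i=1..m. 1 / of_nat i ^ s)"

lemma half_less: "i \<le> m \<Longrightarrow> 2 * i < p"
  using p_eq by simp

lemma integral_inverse_power: "0 < k \<Longrightarrow> k < p \<Longrightarrow> integral (1 / of_nat k ^ s)"
  by simp

lemma integral_half_power_sum [simp]: "integral (half_power_sum s)"
  unfolding half_power_sum_def
  by (intro integral_sum integral_inverse_power) (use half_less in force)+

text \<open>The sum of \<open>1/k^2\<close> over \<open>0 < k < p\<close> is \<open>2 h(2) + 2 p h(3)\<close> by the pairing of \<open>k\<close> with \<open>p - k\<close>, and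
  \<open>h(2)/2 + p h(3)/4\<close> by the even numbers \<open>2i\<close> and the odd numbers \<open>p - 2i\<close>, where \<open>h\<close> is
  \<open>half_power_sum\<close>. The relation is four times the difference.\<close>

lemma half_power_sum_relation:
  "6 * half_power_sum 2 + 7 * P * half_power_sum 3 \<approx>\<^bsub>2\<^esub> 0"
proof -
  define f :: "nat \<Rightarrow> rat" where "f k = 1 / of_nat k ^ 2" for k
  have "sum f {1..2 * m} = (\<Sum>i=1..m. f i + f (p - i))"
    unfolding sum.reflect_halves p_eq ..
  also have "\<dots> \<approx>\<^bsub>2\<^esub> (\<Sum>i=1..m. 1 / of_nat i ^ 2 + (1 / of_nat i ^ 2 + 2 * P * (1 / of_nat i ^ 3)))"
    unfolding f_def using half_less
    by (intro rcong_sum rcong_add rcong_refl inverse_square_reflect integral_inverse_power) force+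
  also have "\<dots> = 2 * half_power_sum 2 + 2 * P * half_power_sum 3"
    by (simp add: half_power_sum_def sum.distrib sum_distrib_left)
  finally have A: "sum f {1..2 * m} \<approx>\<^bsub>2\<^esub> 2 * half_power_sum 2 + 2 * P * half_power_sum 3" .
  have "sum f {1..2 * m} = (\<Sum>i=1..m. f (2 * i) + f (p - 2 * i))"
    unfolding sum.reflect_odd p_eq ..
  also have "\<dots> \<approx>\<^bsub>2\<^esub> (\<Sum>i=1..m. 1 / of_nat (2 * i) ^ 2
      + (1 / of_nat (2 * i) ^ 2 + 2 * P * (1 / of_nat (2 * i) ^ 3)))"
    unfolding f_def using half_less
    by (intro rcong_sum rcong_add rcong_refl inverse_square_reflect integral_inverse_power) force+
  also have "\<dots> = half_power_sum 2 / 2 + P * half_power_sum 3 / 4"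
    by (simp add: half_power_sum_def sum.distrib sum_distrib_left sum_divide_distrib
        power_mult_distrib flip: sum.distrib) (simp add: mult.commute)
  finally have B: "sum f {1..2 * m} \<approx>\<^bsub>2\<^esub> half_power_sum 2 / 2 + P * half_power_sum 3 / 4" .
  have "4 * ((2 * half_power_sum 2 + 2 * P * half_power_sum 3) -
      (half_power_sum 2 / 2 + P * half_power_sum 3 / 4)) \<approx>\<^bsub>2\<^esub> 4 * (sum f {1..2 * m} - sum f {1..2 * m})"
    using A B by (intro rcong_scale rcong_diff rcong_sym[OF A] rcong_sym[OF B]) simp
  then show ?thesis by (simp add: algebra_simps)
qed

lemma half_power_sum_2_cong_0: "half_power_sum 2 \<approx>\<^bsub>1\<^esub> 0"
proof -
  have "6 * half_power_sum 2 = (6 * half_power_sum 2 + 7 * P * half_power_sum 3)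
      - P ^ 1 * (7 * half_power_sum 3)" by simp
  also have "\<dots> \<approx>\<^bsub>1\<^esub> 0 - 0"
    by (intro rcong_diff rcong_P_power_0 rcong_le[OF half_power_sum_relation]) simp_all
  finally have "(1 / 6) * (6 * half_power_sum 2) \<approx>\<^bsub>1\<^esub> (1 / 6) * 0"
    by (intro rcong_scale) simp_all
  then show ?thesis by simp
qed

section \<open>Binomial coefficients modulo powers of the prime\<close>

text \<open>Squaring removes the sign of \<open>binomial(p-1,j)\<close>, which is the product of the factors \<open>p/l - 1\<close>.\<close>

lemma choose_pred_prime_square:
  assumes "j < p"
  shows "(of_nat ((p - 1) choose j))\<^sup>2 \<approx>\<^bsub>2\<^esub> 1 - 2 * P * harmonic j"
proof -
  have P1: "of_nat (p - 1) + 1 = P" using above_3 by (simp add: of_nat_diff)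
  have int: "integral (- (1 / of_nat l))" if "l \<in> {1..j}" for l
    using that assms by auto
  have "(of_nat ((p - 1) choose j))\<^sup>2 = (\<Prod>l=1..j. P / of_nat l - 1)\<^sup>2"
    unfolding choose_eq_prod P1 ..
  also have "\<dots> = (\<Prod>l=1..j. 1 + P ^ 1 * (- (1 / of_nat l)))\<^sup>2"
    unfolding prod_power_distrib by (intro prod.cong refl) (simp add: power2_commute)
  also have "\<dots> \<approx>\<^bsub>2\<^esub> 1 + 2 * P ^ 1 * (\<Sum>l=1..j. - (1 / of_nat l))"
    using int by (intro square_one_plus_rcong prod_one_plus_rcong integral_sum) simp_all
  finally show ?thesis by (simp add: harmonic_def sum_negf)
qed

lemma choose_prime_add_square:
  assumes "j < p"
  shows "(of_nat ((p + j) choose j))\<^sup>2 \<approx>\<^bsub>2\<^esub> 1 + 2 * P * harmonic j"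
proof -
  have int: "integral (1 / of_nat l)" if "l \<in> {1..j}" for l
    using that assms by auto
  have "(of_nat ((p + j) choose j))\<^sup>2 = (\<Prod>l=1..j. 1 + P ^ 1 * (1 / of_nat l))\<^sup>2"
    unfolding choose_add_eq_prod by simp
  also have "\<dots> \<approx>\<^bsub>2\<^esub> 1 + 2 * P ^ 1 * (\<Sum>l=1..j. 1 / of_nat l)"
    using int by (intro square_one_plus_rcong prod_one_plus_rcong integral_sum) simp_all
  finally show ?thesis by (simp add: harmonic_def)
qed

text \<open>The binomial coefficient is twice the product of \<open>1 + p/l\<close> over \<open>0 < l < p\<close>. The factors
  for \<open>i\<close> and \<open>p-i\<close> multiply to \<open>1 + 2p^2/(i(p-i))\<close>, without a term of first order in \<open>p\<close>, so the product
  linearises modulo \<open>p^4\<close>. This is Wolstenholme's theorem with one more power of \<open>p\<close>.\<close>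

lemma wolstenholme_square:
  "(of_nat ((2 * p) choose p))\<^sup>2 \<approx>\<^bsub>4\<^esub> 4 * (1 - 4 * P ^ 2 * (half_power_sum 2 + P * half_power_sum 3))"
proof -
  define a :: "nat \<Rightarrow> rat" where "a i = 2 * (1 / of_nat i) * (1 / of_nat (p - i))" for i
  have int: "integral (a i)" if "i \<in> {1..m}" for i
    unfolding a_def using that half_less[of i] by (intro integral_mult integral_inverse) auto
  have "(of_nat ((2 * p) choose p) :: rat) = (\<Prod>l=1..p. 1 + P / of_nat l)"
    using choose_add_eq_prod[of p p] by (simp add: mult_2)
  also have "\<dots> = 2 * (\<Prod>l=1..2 * m. 1 + P / of_nat l)"
  proof -
    have "{1..p} = insert p {1..2 * m}" "p \<notin> {1..2 * m}" using p_eq by auto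
    then show ?thesis using above_3 by simp
  qed
  also have "(\<Prod>l=1..2 * m. 1 + P / of_nat l) = (\<Prod>i=1..m. (1 + P / of_nat i) * (1 + P / of_nat (p - i)))"
    unfolding prod.reflect_halves p_eq ..
  also have "\<dots> = (\<Prod>i=1..m. 1 + P ^ 2 * a i)"
  proof (rule prod.cong[OF refl])
    fix i assume "i \<in> {1..m}"
    then have "of_nat i \<noteq> (0::rat)" "i < p" using half_less[of i] by auto
    then show "(1 + P / of_nat i) * (1 + P / of_nat (p - i)) = 1 + P ^ 2 * a i"
      using P_minus_nonzero[of i] unfolding a_def
      by (simp add: of_nat_p_minus) (simp add: field_simps power2_eq_square)
  qed
  finally have eq: "of_nat ((2 * p) choose p) = 2 * (\<Prod>i=1..m. 1 + P ^ 2 * a i)" .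
  have "(\<Sum>i=1..m. a i) \<approx>\<^bsub>2\<^esub> (\<Sum>i=1..m. - 2 * (1 / of_nat i ^ 2 + P * (1 / of_nat i ^ 3)))"
  proof (rule rcong_sum)
    fix i assume i: "i \<in> {1..m}"
    define K L where "K = (of_nat i :: rat)" and "L = P - K"
    have ip: "0 < i" "i < p" using i half_less[of i] by auto
    have nz: "K \<noteq> 0" "L \<noteq> 0" and L: "of_nat (p - i) = L" and P: "P = K + L"
      using ip by (auto simp: K_def L_def of_nat_p_minus)
    have ints: "invertible K" "invertible L"
      using ip invertible_less[of i] invertible_less[of "p - i"] L K_def by simp_all
    have "2 * (1 / K) * (1 / L) - - 2 * (1 / K ^ 2 + P * (1 / K ^ 3))
        = P ^ 2 * (2 * (1 / K ^ 3) * (1 / L))"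
      unfolding P using nz
      by (simp add: divide_simps) (simp add: algebra_simps eval_nat_numeral)
    then show "a i \<approx>\<^bsub>2\<^esub> - 2 * (1 / of_nat i ^ 2 + P * (1 / of_nat i ^ 3))"
      unfolding a_def L K_def[symmetric] using ints
      by (intro rcongI[where z = "2 * (1 / K ^ 3) * (1 / L)"] integral_mult integral_add integral_uminus) simp_all
  qed
  also have "\<dots> = - 2 * (half_power_sum 2 + P * half_power_sum 3)"
    unfolding half_power_sum_def sum_distrib_left sum.distrib[symmetric] ..
  finally have sum_a: "(\<Sum>i=1..m. a i) \<approx>\<^bsub>2\<^esub> - 2 * (half_power_sum 2 + P * half_power_sum 3)" .
  have "(of_nat ((2 * p) choose p))\<^sup>2 = 4 * (\<Prod>i=1..m. 1 + P ^ 2 * a i)\<^sup>2"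
    unfolding eq by (simp add: power_mult_distrib)
  also have "\<dots> \<approx>\<^bsub>4\<^esub> 4 * (1 + 2 * P ^ 2 * (\<Sum>i=1..m. a i))"
    using int by (intro rcong_scale square_one_plus_rcong prod_one_plus_rcong integral_sum) simp_all
  also have "\<dots> = 4 + 8 * (P ^ 2 * (\<Sum>i=1..m. a i))" by simp
  also have "\<dots> \<approx>\<^bsub>4\<^esub> 4 + 8 * (P ^ 2 * (- 2 * (half_power_sum 2 + P * half_power_sum 3)))"
    by (intro rcong_add rcong_mult_P_power[OF sum_a] rcong_scale rcong_refl) simp_all
  finally show ?thesis by (simp add: algebra_simps)
qed

text \<open>Put \<open>e(x)\<close> for the product of \<open>1 - x/i\<close> over \<open>i \<le> m\<close>. The two rearrangements of the factors of
  \<open>(2m)!\<close> show that \<open>c = binomial(2m,m)\<close> equals both \<open>(-1)^m e(p)\<close> and \<open>(-4)^m e(p/2)\<close>. Hence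
  \<open>c^2 / 16^(2m) = e(p/2)^4 / e(p)^2\<close>, and in this combination of powers the first-order term of each
  factor cancels: \<open>(1-x/2)^4 / (1-x)^2 = 1 + x^2/2 + x^3/2\<close> up to order \<open>x^4\<close>, at \<open>x = p/i\<close>.
  This refines Morley's congruence.\<close>

lemma central_choose_square:
  "(of_nat ((2 * m) choose m))\<^sup>2
    \<approx>\<^bsub>4\<^esub> 16 ^ (p - 1) * (1 + P ^ 2 * ((half_power_sum 2 + P * half_power_sum 3) / 2))"
proof -
  define c :: rat where "c = of_nat ((2 * m) choose m)"
  define e where "e x = (\<Prod>i=1..m. 1 - x / of_nat i)" for x :: rat
  define a where "a i = (1 / of_nat i ^ 2 + P * (1 / of_nat i ^ 3)) / 2" for i
  have lt: "i < p" "2 * i < p" if "i \<in> {1..m}" for i using that half_less[of i] by auto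
  have fact_m: "(fact m :: rat) = (\<Prod>i=1..m. of_nat i)"
    by (simp add: fact_prod)
  have fact_2m: "(fact (2 * m) :: rat) = (\<Prod>i=1..2 * m. of_nat i)"
    by (simp add: fact_prod)
  have c_fact: "c = fact (2 * m) / (fact m * fact m)"
    unfolding c_def by (subst binomial_fact) simp_all
  have "c = (\<Prod>i=1..m. of_nat i * of_nat (p - i) / (of_nat i * of_nat i))"
    unfolding c_fact fact_2m fact_m prod.reflect_halves p_eq prod_dividef prod.distrib ..
  also have "\<dots> = (\<Prod>i=1..m. - 1 * (1 - P / of_nat i))"
    using lt by (intro prod.cong refl) (auto simp: of_nat_p_minus less_imp_le field_simps)
  also have "\<dots> = (- 1) ^ m * e P"
    unfolding prod.distrib e_def by simp
  finally have c1: "c = (- 1) ^ m * e P" .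
  have "c = (\<Prod>i=1..m. of_nat (2 * i) * of_nat (p - 2 * i) / (of_nat i * of_nat i))"
    unfolding c_fact fact_2m fact_m prod.reflect_odd p_eq prod_dividef prod.distrib ..
  also have "\<dots> = (\<Prod>i=1..m. - 4 * (1 - P / 2 / of_nat i))"
    using lt by (intro prod.cong refl) (auto simp: of_nat_p_minus less_imp_le field_simps)
  also have "\<dots> = (- 4) ^ m * e (P / 2)"
    unfolding prod.distrib e_def by simp
  finally have c2: "c = (- 4) ^ m * e (P / 2)" .
  have "c \<noteq> 0" by (simp add: c_def)
  then have nz: "e P \<noteq> 0" "e (P / 2) \<noteq> 0" using c1 c2 by auto
  have sq1: "c\<^sup>2 = (e P)\<^sup>2" unfolding c1 by (simp add: power_mult_distrib flip: power_mult)
  have sq2: "c\<^sup>2 = 16 ^ m * (e (P / 2))\<^sup>2"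
  proof -
    have "((- 4) ^ m)\<^sup>2 = (16::rat) ^ m" by (simp add: power2_eq_square flip: power_mult_distrib)
    then show ?thesis unfolding c2 power_mult_distrib by simp
  qed
  have "(16 :: rat) ^ (p - 1) = (16 ^ m)\<^sup>2"
    unfolding p_minus_1 by (simp flip: power_mult add: mult.commute)
  then have "c\<^sup>2 = 16 ^ (p - 1) * ((e (P / 2)) ^ 4 / (e P)\<^sup>2)"
  proof -
    have "c\<^sup>2 * (e P)\<^sup>2 = c\<^sup>2 * c\<^sup>2" by (simp add: sq1)
    also have "\<dots> = 16 ^ (p - 1) * e (P / 2) ^ 4"
      unfolding sq2 \<open>16 ^ (p - 1) = (16 ^ m)\<^sup>2\<close> by (simp add: eval_nat_numeral)
    finally show ?thesis using nz by (simp add: field_simps)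
  qed
  also have "(e (P / 2)) ^ 4 / (e P)\<^sup>2
      = (\<Prod>i=1..m. (1 - P / 2 / of_nat i) ^ 4 / (1 - P / of_nat i)\<^sup>2)"
    unfolding e_def prod_power_distrib prod_dividef ..
  also have "16 ^ (p - 1) * \<dots> \<approx>\<^bsub>4\<^esub> 16 ^ (p - 1) * (\<Prod>i=1..m. 1 + P ^ 2 * a i)"
  proof (intro rcong_scale rcong_prod)
    fix i assume i: "i \<in> {1..m}"
    define K L where "K = (of_nat i :: rat)" and "L = P - K"
    have ip: "0 < i" "i < p" using i half_less[of i] by auto
    have nz: "K \<noteq> 0" "L \<noteq> 0" and L: "of_nat (p - i) = L" and P: "P = K + L"
      using ip by (auto simp: K_def L_def of_nat_p_minus)
    have ints: "invertible K" "invertible L"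
      using ip invertible_less[of i] invertible_less[of "p - i"] L K_def by simp_all
    \<comment> \<open>\<open>(1-x/2)^4 - (1-x)^2 (1+x^2/2+x^3/2) = x^4 (9/16 - x/2)\<close>, with \<open>x = P/K\<close> and \<open>(1-x)^2 = L^2/K^2\<close>\<close>
    define z where "z = (9 / 16 - P / 2 * (1 / K)) * (1 / K ^ 2) * (1 / L ^ 2)"
    have "(1 - P / 2 / K) ^ 4 / (1 - P / K)\<^sup>2
        - (1 + P ^ 2 * ((1 / K ^ 2 + P * (1 / K ^ 3)) / 2)) = P ^ 4 * z"
    proof -
      have "1 - P / K = - (L / K)" using nz P by (simp add: field_simps)
      then have "(1 - P / K)\<^sup>2 = L\<^sup>2 / K\<^sup>2" by (simp add: power_divide)
      moreover have "1 - P / 2 / K = (K - L) / (2 * K)" using nz P by (simp add: field_simps)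
      ultimately show ?thesis
        unfolding z_def unfolding P using nz
        by (simp add: power_divide divide_simps) (simp add: algebra_simps eval_nat_numeral)
    qed
    moreover have "integral z" unfolding z_def using ints by simp
    ultimately show "(1 - P / 2 / of_nat i) ^ 4 / (1 - P / of_nat i)\<^sup>2 \<approx>\<^bsub>4\<^esub> 1 + P ^ 2 * a i"
      unfolding a_def K_def[symmetric] using ints
      by (intro rcongI[where z = z]) simp_all
  qed simp
  also have "\<dots> \<approx>\<^bsub>4\<^esub> 16 ^ (p - 1) * (1 + P ^ 2 * (\<Sum>i=1..m. a i))"
    unfolding a_def using lt by (intro rcong_scale prod_one_plus_rcong) simp_all
  also have "(\<Sum>i=1..m. a i) = (half_power_sum 2 + P * half_power_sum 3) / 2"
    unfolding a_def half_power_sum_def sum_divide_distrib[symmetric] sum.distrib sum_distrib_left ..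
  finally show ?thesis unfolding c_def by simp
qed

section \<open>The values at the prime and below it\<close>

definition weighted_harmonic :: "(nat \<Rightarrow> nat) \<Rightarrow> rat" where
  "weighted_harmonic g = (\<Sum>i=1..m. 1 / of_nat i ^ 2 * harmonic (g i))"

lemma integral_weighted_harmonic:
  assumes "\<And>i. i \<in> {1..m} \<Longrightarrow> g i < p"
  shows "integral (weighted_harmonic g)"
  unfolding weighted_harmonic_def
  using assms half_less by (intro integral_sum integral_mult integral_inverse_power) force+

lemma integral_weighted_harmonics [simp]:
  "integral (weighted_harmonic (\<lambda>i. i - 1))"
  "integral (weighted_harmonic (\<lambda>i. 2 * i - 1))"
  "integral (weighted_harmonic (\<lambda>i. m - i))"
  by (rule integral_weighted_harmonic; use half_less in force)+

lemma one_plus_mult_rcong: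
  assumes "integral x" "integral y"
  shows "(1 - 2 * P * x) * (1 + 2 * P * y) \<approx>\<^bsub>2\<^esub> 1 - 2 * P * x + 2 * P * y"
  using assms by (intro rcongI[where z = "- (4 * x * y)"]) (simp_all add: algebra_simps power2_eq_square)

text \<open>The factor \<open>p^2\<close> comes from \<open>binomial(p,i) = (p/i) binomial(p-1,i-1)\<close>. The other binomial
  coefficient, \<open>binomial(2(p-i),p)\<close>, involves \<open>H(p-2i)\<close>, which reflects to \<open>H(2i-1)\<close> modulo \<open>p\<close>.\<close>

lemma summand_prime:
  assumes i: "i \<in> {1..m}"
  shows "(summand p (p - i))\<^sup>2
    \<approx>\<^bsub>4\<^esub> P\<^sup>2 * (1 / of_nat i ^ 2 * (1 - 2 * P * harmonic (i - 1) + 2 * P * harmonic (2 * i - 1)))"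
proof -
  define b c where "b = (of_nat ((p - 1) choose (i - 1)) :: rat)"
    and "c = (of_nat ((p + (p - 2 * i)) choose (p - 2 * i)) :: rat)"
  have lt: "0 < i" "i < p" "2 * i < p" using i half_less[of i] by auto
  have "of_nat i * of_nat (p choose i) = P * b"
    using of_nat_choose_absorb[of "i - 1" "p - 1"] lt by (simp add: b_def)
  then have "of_nat (p choose (p - i)) = P * (1 / of_nat i) * b"
    using lt binomial_symmetric[of i p] by (simp add: field_simps)
  moreover have "2 * (p - i) = p + (p - 2 * i)" using lt by simp
  then have "(2 * (p - i)) choose p = (p + (p - 2 * i)) choose (p - 2 * i)"
    using binomial_symmetric[of p "p + (p - 2 * i)"] by simp
  ultimately have "(summand p (p - i))\<^sup>2 = P\<^sup>2 * (1 / of_nat i ^ 2 * (b\<^sup>2 * c\<^sup>2))"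
    unfolding summand_def by (simp add: c_def power_mult_distrib power_divide)
  also have "\<dots> \<approx>\<^bsub>4\<^esub> P\<^sup>2 * (1 / of_nat i ^ 2 * (1 - 2 * P * harmonic (i - 1) + 2 * P * harmonic (2 * i - 1)))"
  proof (intro rcong_mult_P_power[where n = 2] rcong_scale integral_inverse_power lt)
    have "c\<^sup>2 \<approx>\<^bsub>2\<^esub> 1 + 2 * P * harmonic (p - 2 * i)"
      unfolding c_def using lt by (intro choose_prime_add_square) simp
    also have "\<dots> = 1 + 2 * (P ^ 1 * harmonic (p - 1 - (2 * i - 1)))"
      using lt by simp
    also have "\<dots> \<approx>\<^bsub>2\<^esub> 1 + 2 * (P ^ 1 * harmonic (2 * i - 1))"
      using lt by (intro rcong_add rcong_refl rcong_mult_P_power[where n = 1] rcong_scale harmonic_reflect) simp_all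
    finally have "c\<^sup>2 \<approx>\<^bsub>2\<^esub> 1 + 2 * P * harmonic (2 * i - 1)"
      by (simp add: mult.assoc)
    moreover have "b\<^sup>2 \<approx>\<^bsub>2\<^esub> 1 - 2 * P * harmonic (i - 1)"
      unfolding b_def using lt by (intro choose_pred_prime_square) simp
    ultimately have "b\<^sup>2 * c\<^sup>2 \<approx>\<^bsub>2\<^esub> (1 - 2 * P * harmonic (i - 1)) * (1 + 2 * P * harmonic (2 * i - 1))"
      by (rule rcong_mult[rotated])
    also have "\<dots> \<approx>\<^bsub>2\<^esub> 1 - 2 * P * harmonic (i - 1) + 2 * P * harmonic (2 * i - 1)"
      using lt by (intro one_plus_mult_rcong) simp_all
    finally show "b\<^sup>2 * c\<^sup>2 \<approx>\<^bsub>2\<^esub> 1 - 2 * P * harmonic (i - 1) + 2 * P * harmonic (2 * i - 1)" .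
  qed simp
  finally show ?thesis .
qed

text \<open>Here the factor \<open>p^2/4\<close> comes from
  \<open>binomial(2m+2i,2i) = (p/(2i)) binomial(p+2i-1,2i-1)\<close>.\<close>

lemma summand_pred_prime:
  assumes i: "i \<in> {1..m}"
  shows "(summand (p - 1) (m + i))\<^sup>2
    \<approx>\<^bsub>4\<^esub> P\<^sup>2 * (1 / of_nat i ^ 2 * (1 - 2 * P * harmonic (m - i) + 2 * P * harmonic (2 * i - 1))) / 4"
proof -
  define b c where "b = (of_nat ((p - 1) choose (m - i)) :: rat)"
    and "c = (of_nat ((p + (2 * i - 1)) choose (2 * i - 1)) :: rat)"
  have lt: "0 < i" "i < p" "2 * i < p" "i \<le> m" using i half_less[of i] by auto
  have "of_nat ((p - 1) choose (m + i)) = b"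
  proof -
    have "2 * m - (m - i) = m + i" using lt by simp
    then show ?thesis
      unfolding b_def p_minus_1 using binomial_symmetric[of "m - i" "2 * m"] by simp
  qed
  moreover have "of_nat ((2 * (m + i)) choose (p - 1)) = P * (1 / of_nat i) * c / 2"
  proof -
    have "(2 * of_nat i) * (of_nat ((2 * (m + i)) choose (2 * i)) :: rat)
        = (of_nat (2 * (m + i)) - of_nat (2 * i - 1)) * of_nat ((2 * (m + i)) choose (2 * i - 1))"
      using of_nat_choose_succ_lower[of "2 * i - 1" "2 * (m + i)"] lt by simp
    also have "of_nat (2 * (m + i)) - of_nat (2 * i - 1) = (of_nat (2 * (m + i) - (2 * i - 1)) :: rat)"
      using lt by (simp add: of_nat_diff)
    also have "2 * (m + i) - (2 * i - 1) = p" using lt p_eq by simp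
    also have "2 * (m + i) = p + (2 * i - 1)" using lt p_eq by simp
    finally have "(2 * of_nat i) * (of_nat ((p + (2 * i - 1)) choose (2 * i)) :: rat) = P * c"
      by (simp add: c_def)
    moreover have "(2 * (m + i)) choose (p - 1) = (2 * (m + i)) choose (2 * i)"
      unfolding p_minus_1 using binomial_symmetric[of "2 * i" "2 * (m + i)"] by simp
    moreover have "2 * (m + i) = p + (2 * i - 1)" using lt p_eq by simp
    ultimately show ?thesis using lt by (simp add: field_simps)
  qed
  ultimately have "(summand (p - 1) (m + i))\<^sup>2 = 1 / 4 * (P\<^sup>2 * (1 / of_nat i ^ 2 * (b\<^sup>2 * c\<^sup>2)))"
    unfolding summand_def by (simp add: power_mult_distrib power_divide mult_ac)
  also have "\<dots> \<approx>\<^bsub>4\<^esub> 1 / 4 * (P\<^sup>2 * (1 / of_nat i ^ 2 * (1 - 2 * P * harmonic (m - i) + 2 * P * harmonic (2 * i - 1))))"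
  proof (intro rcong_mult_P_power[where n = 2] rcong_scale integral_inverse_power lt)
    have "c\<^sup>2 \<approx>\<^bsub>2\<^esub> 1 + 2 * P * harmonic (2 * i - 1)"
      unfolding c_def using lt by (intro choose_prime_add_square) simp
    moreover have "b\<^sup>2 \<approx>\<^bsub>2\<^esub> 1 - 2 * P * harmonic (m - i)"
      unfolding b_def using lt p_eq by (intro choose_pred_prime_square) simp
    ultimately have "b\<^sup>2 * c\<^sup>2 \<approx>\<^bsub>2\<^esub> (1 - 2 * P * harmonic (m - i)) * (1 + 2 * P * harmonic (2 * i - 1))"
      by (rule rcong_mult[rotated])
    also have "\<dots> \<approx>\<^bsub>2\<^esub> 1 - 2 * P * harmonic (m - i) + 2 * P * harmonic (2 * i - 1)"
      using lt p_eq by (intro one_plus_mult_rcong) simp_all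
    finally show "b\<^sup>2 * c\<^sup>2 \<approx>\<^bsub>2\<^esub> 1 - 2 * P * harmonic (m - i) + 2 * P * harmonic (2 * i - 1)" .
  qed simp_all
  finally show ?thesis by (simp add: mult_ac)
qed

lemma sum_weights:
  "(\<Sum>i=1..m. P\<^sup>2 * (1 / of_nat i ^ 2 * (1 - 2 * P * harmonic (g i) + 2 * P * harmonic (g' i))))
    = P\<^sup>2 * (half_power_sum 2 - 2 * P * weighted_harmonic g + 2 * P * weighted_harmonic g')"
proof -
  have "1 / of_nat i ^ 2 * (1 - 2 * P * harmonic (g i) + 2 * P * harmonic (g' i))
      = 1 / of_nat i ^ 2 - 2 * P * (1 / of_nat i ^ 2 * harmonic (g i))
        + 2 * P * (1 / of_nat i ^ 2 * harmonic (g' i))" for i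
    by (simp add: algebra_simps)
  then show ?thesis
    by (simp only: half_power_sum_def weighted_harmonic_def sum_distrib_left[symmetric]
        sum.distrib sum_subtractf)
qed

lemma T_prime:
  "of_nat (T p) \<approx>\<^bsub>4\<^esub> 4 * (1 + P\<^sup>2 * ((half_power_sum 2 - 2 * P * weighted_harmonic (\<lambda>i. i - 1)
      + 2 * P * weighted_harmonic (\<lambda>i. 2 * i - 1)) / 4 - 4 * (half_power_sum 2 + P * half_power_sum 3)))"
proof -
  have "of_nat (T p) = (\<Sum>i=0..p. (summand p (p - i))\<^sup>2)"
    unfolding T_eq_sum_summand by (subst sum.atLeastAtMost_rev) simp
  also have "\<dots> = (\<Sum>i=0..m. (summand p (p - i))\<^sup>2)"
    by (rule sum.mono_neutral_right) (use p_eq in \<open>auto simp: summand_def binomial_eq_0\<close>)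
  also have "\<dots> = (of_nat ((2 * p) choose p))\<^sup>2 + (\<Sum>i=1..m. (summand p (p - i))\<^sup>2)"
    by (simp add: sum.atLeast_Suc_atMost summand_def)
  also have "\<dots> \<approx>\<^bsub>4\<^esub> 4 * (1 - 4 * P ^ 2 * (half_power_sum 2 + P * half_power_sum 3))
      + (\<Sum>i=1..m. P\<^sup>2 * (1 / of_nat i ^ 2
          * (1 - 2 * P * harmonic (i - 1) + 2 * P * harmonic (2 * i - 1))))"
    by (intro rcong_add wolstenholme_square rcong_sum summand_prime)
  also have "\<dots> = 4 * (1 + P\<^sup>2 * ((half_power_sum 2 - 2 * P * weighted_harmonic (\<lambda>i. i - 1)
      + 2 * P * weighted_harmonic (\<lambda>i. 2 * i - 1)) / 4 - 4 * (half_power_sum 2 + P * half_power_sum 3)))"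
    unfolding sum_weights by (simp add: field_simps)
  finally show ?thesis .
qed

lemma power_16_cong_1: "16 ^ (p - 1) \<approx>\<^bsub>1\<^esub> 1"
proof -
  have "\<not> p dvd 16"
  proof
    assume "p dvd 16"
    then have "p dvd 2 ^ 4" by simp
    then have "p dvd 2" using prime prime_dvd_power by blast
    then show False using above_3 by (auto dest: dvd_imp_le)
  qed
  then have "[16 ^ (p - 1) = 1] (mod p)"
    using fermat_theorem[OF prime] by blast
  then have "[int (16 ^ (p - 1)) = int 1] (mod int p)"
    by (simp only: cong_int_iff)
  then obtain k where "int (16 ^ (p - 1)) - int 1 = int p * k"
    by (metis cong_iff_dvd_diff dvd_def)
  then have "of_int (int (16 ^ (p - 1)) - int 1) = (of_int (int p * k) :: rat)" by simp
  then show ?thesis by (intro rcongI[where z = "of_int k"]) simp_all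
qed

text \<open>The terms other than the central one do not contain \<open>16^(p-1)\<close>. Their sum is divisible by \<open>p^3\<close>,
  because \<open>half_power_sum 2\<close> is divisible by \<open>p\<close>; as \<open>16^(p-1) = 1\<close> modulo \<open>p\<close>, the power of \<open>16\<close> may be
  inserted.\<close>

lemma T_pred_prime:
  "of_nat (T (p - 1)) \<approx>\<^bsub>4\<^esub> 16 ^ (p - 1) * (1 + P\<^sup>2 * ((half_power_sum 2 + P * half_power_sum 3) / 2
    + (half_power_sum 2 - 2 * P * weighted_harmonic (\<lambda>i. m - i)
      + 2 * P * weighted_harmonic (\<lambda>i. 2 * i - 1)) / 4))"
proof -
  define w where "w = half_power_sum 2 - 2 * P * weighted_harmonic (\<lambda>i. m - i)
      + 2 * P * weighted_harmonic (\<lambda>i. 2 * i - 1)"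
  define y where "y = (16 ^ (p - 1) :: rat)"
  define d where "d = (half_power_sum 2 + P * half_power_sum 3) / 2"
  have ints: "integral (weighted_harmonic (\<lambda>i. m - i))" "integral (weighted_harmonic (\<lambda>i. 2 * i - 1))"
    by (rule integral_weighted_harmonics)+
  then have intw: "integral w" by (simp add: w_def)
  have intd: "integral d" by (simp add: d_def)
  have inty: "integral y" by (simp add: y_def)
  have "of_nat (T (p - 1)) = (\<Sum>k=0..2 * m. (summand (p - 1) k)\<^sup>2)"
    unfolding T_eq_sum_summand p_minus_1 ..
  also have "\<dots> = (\<Sum>k=m..2 * m. (summand (p - 1) k)\<^sup>2)"
    unfolding p_minus_1
    by (rule sum.mono_neutral_right) (auto simp: summand_def binomial_eq_0)
  also have "\<dots> = (\<Sum>i=0..m. (summand (p - 1) (m + i))\<^sup>2)"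
    by (rule sum.reindex_bij_witness[of _ "\<lambda>i. m + i" "\<lambda>k. k - m"]) auto
  also have "\<dots> = (of_nat ((2 * m) choose m))\<^sup>2 + (\<Sum>i=1..m. (summand (p - 1) (m + i))\<^sup>2)"
    unfolding p_minus_1 by (simp add: sum.atLeast_Suc_atMost summand_def)
  also have "\<dots> \<approx>\<^bsub>4\<^esub> y * (1 + P ^ 2 * d)
      + (\<Sum>i=1..m. P\<^sup>2 * (1 / of_nat i ^ 2
          * (1 - 2 * P * harmonic (m - i) + 2 * P * harmonic (2 * i - 1))) / 4)"
    unfolding y_def d_def
    by (intro rcong_add central_choose_square rcong_sum summand_pred_prime)
  also have "\<dots> = y * (1 + P ^ 2 * d) + P ^ 2 * (1 / 4 * w)"
    unfolding sum_divide_distrib[symmetric] sum_weights w_def by simp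
  also have "\<dots> \<approx>\<^bsub>4\<^esub> y * (1 + P ^ 2 * d) + P ^ 2 * (1 / 4 * (y * w))"
  proof (intro rcong_add rcong_refl rcong_mult_P_power[where n = 2] rcong_scale)
    have "w = half_power_sum 2 + P ^ 1 * (- 2 * weighted_harmonic (\<lambda>i. m - i)
        + 2 * weighted_harmonic (\<lambda>i. 2 * i - 1))"
      by (simp add: w_def algebra_simps)
    also have "\<dots> \<approx>\<^bsub>1\<^esub> 0 + 0"
      using ints by (intro rcong_add half_power_sum_2_cong_0 rcong_P_power_0 integral_add integral_mult) simp_all
    finally obtain v where v: "integral v" "w = P ^ 1 * v" by (auto simp: rcong_iff)
    have "y * v \<approx>\<^bsub>1\<^esub> 1 * v"
      unfolding y_def by (intro rcong_mult power_16_cong_1 rcong_refl v)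
    then have "P ^ 1 * (1 * v) \<approx>\<^bsub>2\<^esub> P ^ 1 * (y * v)"
      by (intro rcong_mult_P_power[OF rcong_sym]) simp_all
    then show "w \<approx>\<^bsub>2\<^esub> y * w" by (simp add: v mult.left_commute)
  qed (use inty intd in simp_all)
  also have "\<dots> = y * (1 + P ^ 2 * (d + w / 4))" by (simp add: algebra_simps)
  finally show ?thesis unfolding y_def d_def w_def .
qed

text \<open>Weighting \<open>harmonic_half_minus\<close> by \<open>1/i^2\<close> produces the extra term
  \<open>harmonic m * half_power_sum 2\<close>, which is divisible by \<open>p\<close>.\<close>

lemma weighted_harmonic_relation:
  "weighted_harmonic (\<lambda>i. m - i)
    \<approx>\<^bsub>1\<^esub> 2 * weighted_harmonic (\<lambda>i. 2 * i - 1) - weighted_harmonic (\<lambda>i. i - 1)"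
proof -
  have "weighted_harmonic (\<lambda>i. m - i) \<approx>\<^bsub>1\<^esub> (\<Sum>i=1..m. 1 / of_nat i ^ 2
      * (harmonic m + 2 * harmonic (2 * i - 1) - harmonic (i - 1)))"
    unfolding weighted_harmonic_def
  proof (rule rcong_sum)
    fix i assume "i \<in> {1..m}"
    then have "0 < i" "i < p" "i \<le> m" using half_less[of i] by auto
    then show "1 / of_nat i ^ 2 * harmonic (m - i) \<approx>\<^bsub>1\<^esub> 1 / of_nat i ^ 2
        * (harmonic m + 2 * harmonic (2 * i - 1) - harmonic (i - 1))"
      by (intro rcong_scale harmonic_half_minus integral_inverse_power)
  qed
  also have "\<dots> = harmonic m * half_power_sum 2
      + (2 * weighted_harmonic (\<lambda>i. 2 * i - 1) - weighted_harmonic (\<lambda>i. i - 1))"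
  proof -
    have "1 / of_nat i ^ 2 * (harmonic m + 2 * harmonic (2 * i - 1) - harmonic (i - 1))
        = harmonic m * (1 / of_nat i ^ 2) + (2 * (1 / of_nat i ^ 2 * harmonic (2 * i - 1))
          - 1 / of_nat i ^ 2 * harmonic (i - 1))" for i
      by (simp add: algebra_simps)
    then show ?thesis
      by (simp only: weighted_harmonic_def half_power_sum_def sum_distrib_left[symmetric]
          sum.distrib sum_subtractf)
  qed
  also have "\<dots> \<approx>\<^bsub>1\<^esub> harmonic m * 0
      + (2 * weighted_harmonic (\<lambda>i. 2 * i - 1) - weighted_harmonic (\<lambda>i. i - 1))"
    using half_less[of m] p_eq
    by (intro rcong_add rcong_scale half_power_sum_2_cong_0 rcong_refl integral_diff
        integral_mult integral_weighted_harmonics) simp_all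
  finally show ?thesis by simp
qed

text \<open>With \<open>a\<close> and \<open>b\<close> the coefficients of \<open>p^2\<close> in \<open>T_prime\<close> and \<open>T_pred_prime\<close>, the product is
  \<open>4 * 16^(p-1) * (1 + p^2 (a + b))\<close> modulo \<open>p^4\<close>. Here
  \<open>a + b = -(6 h(2) + 7 p h(3)) / 2 + p (2 s2 - s1 - s3) / 2\<close>, where the first part is divisible by \<open>p^2\<close> by
  \<open>half_power_sum_relation\<close> and the bracket by \<open>p\<close> by \<open>weighted_harmonic_relation\<close>.\<close>

lemma T_values:
  shows "of_nat (T p) \<approx>\<^bsub>2\<^esub> 4"
    and "of_nat (T (p - 1)) \<approx>\<^bsub>2\<^esub> 16 ^ (p - 1)"
    and "of_nat (T p) * of_nat (T (p - 1)) \<approx>\<^bsub>4\<^esub> 4 * 16 ^ (p - 1)"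
proof -
  define h2 h3 where "h2 = half_power_sum 2" and "h3 = half_power_sum 3"
  define s1 s2 s3 where "s1 = weighted_harmonic (\<lambda>i. i - 1)"
    and "s2 = weighted_harmonic (\<lambda>i. 2 * i - 1)" and "s3 = weighted_harmonic (\<lambda>i. m - i)"
  define a where "a = (h2 - 2 * P * s1 + 2 * P * s2) / 4 - 4 * (h2 + P * h3)"
  define b where "b = (h2 + P * h3) / 2 + (h2 - 2 * P * s3 + 2 * P * s2) / 4"
  define y where "y = (16 ^ (p - 1) :: rat)"
  have ints: "integral h2" "integral h3" "integral s1" "integral s2" "integral s3"
    unfolding h2_def h3_def s1_def s2_def s3_def
    by (rule integral_weighted_harmonics integral_half_power_sum)+
  have int: "integral a" "integral b" "integral y"
    unfolding a_def b_def y_def using ints by simp_all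
  have A: "of_nat (T p) \<approx>\<^bsub>4\<^esub> 4 * (1 + P ^ 2 * a)"
    unfolding a_def h2_def h3_def s1_def s2_def by (rule T_prime)
  have B: "of_nat (T (p - 1)) \<approx>\<^bsub>4\<^esub> y * (1 + P ^ 2 * b)"
    unfolding b_def h2_def h3_def s2_def s3_def y_def by (rule T_pred_prime)
  have "of_nat (T p) \<approx>\<^bsub>2\<^esub> 4 * (1 + P ^ 2 * a)" by (rule rcong_le[OF A]) simp
  also have "\<dots> \<approx>\<^bsub>2\<^esub> 4 * (1 + 0)"
    using int by (intro rcong_scale rcong_add rcong_P_power_0 rcong_refl) simp_all
  finally show "of_nat (T p) \<approx>\<^bsub>2\<^esub> 4" by simp
  have "of_nat (T (p - 1)) \<approx>\<^bsub>2\<^esub> y * (1 + P ^ 2 * b)" by (rule rcong_le[OF B]) simp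
  also have "\<dots> \<approx>\<^bsub>2\<^esub> y * (1 + 0)"
    using int by (intro rcong_scale rcong_add rcong_P_power_0 rcong_refl) simp_all
  finally show "of_nat (T (p - 1)) \<approx>\<^bsub>2\<^esub> 16 ^ (p - 1)" by (simp add: y_def)
  have ab: "a + b \<approx>\<^bsub>2\<^esub> 0"
  proof -
    have "a + b = - (1 / 2) * (6 * h2 + 7 * P * h3) + 1 / 2 * (P ^ 1 * (2 * s2 - s1 - s3))"
      by (simp add: a_def b_def field_simps)
    also have "\<dots> \<approx>\<^bsub>2\<^esub> - (1 / 2) * 0 + 1 / 2 * 0"
    proof (intro rcong_add rcong_scale)
      show "6 * h2 + 7 * P * h3 \<approx>\<^bsub>2\<^esub> 0"
        unfolding h2_def h3_def by (rule half_power_sum_relation)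
      have "P ^ 1 * (2 * s2 - s1 - s3) \<approx>\<^bsub>2\<^esub> P ^ 1 * (2 * s2 - s1 - (2 * s2 - s1))"
        using ints unfolding s1_def s2_def s3_def
        by (intro rcong_mult_P_power[where n = 1] rcong_diff[OF rcong_refl] weighted_harmonic_relation) simp_all
      then show "P ^ 1 * (2 * s2 - s1 - s3) \<approx>\<^bsub>2\<^esub> 0" by simp
    qed simp_all
    finally show ?thesis by simp
  qed
  have "of_nat (T p) * of_nat (T (p - 1)) \<approx>\<^bsub>4\<^esub> (4 * (1 + P ^ 2 * a)) * (y * (1 + P ^ 2 * b))"
    by (rule rcong_mult[OF A B])
  also have "\<dots> = 4 * y * (1 + P ^ 2 * (a + b) + P ^ 4 * (a * b))"
    by (simp add: algebra_simps eval_nat_numeral)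
  also have "\<dots> \<approx>\<^bsub>4\<^esub> 4 * y * (1 + P ^ 2 * 0 + 0)"
    using int by (intro rcong_add rcong_mult_P_power[OF ab] rcong_P_power_0 rcong_scale rcong_refl) simp_all
  finally show "of_nat (T p) * of_nat (T (p - 1)) \<approx>\<^bsub>4\<^esub> 4 * 16 ^ (p - 1)"
    by (simp add: y_def)
qed

end

section \<open>The congruence modulo the eighth power\<close>

theorem theorem4p3:
  fixes p :: nat
  assumes "prime p" and "p > 3"
  shows "rat_cong p 8
    (\<Sum>n=0..p-1. (3 * (2 * of_nat n + 1) ^ 5 - 2 * (2 * of_nat n + 1) ^ 3 - (2 * of_nat n + 1))
        * ((of_nat (T n))\<^sup>2 / 16 ^ n))
    (- 8 * of_nat p ^ 4 + 8 * of_nat p ^ 6)"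
proof -
  have "odd p" using assms prime_odd_nat by auto
  then obtain m where m: "p = 2 * m + 1" by (elim oddE)
  interpret prime_above_3 p m
    using assms m by unfold_locales simp_all
  define t s y where "t = (of_nat (T p) :: rat)" and "s = (of_nat (T (p - 1)) :: rat)"
    and "y = (16 ^ (p - 1) :: rat)"
  have "invertible y" "integral y" "y \<noteq> 0" by (simp_all add: y_def)
  note y = this
  have t: "t \<approx>\<^bsub>2\<^esub> 4" and s: "s \<approx>\<^bsub>2\<^esub> y" and ts: "t * s \<approx>\<^bsub>4\<^esub> 4 * y"
    unfolding t_def s_def y_def by (rule T_values)+
  have squares: "(t\<^sup>2 + 16 * s\<^sup>2) / (16 * y) \<approx>\<^bsub>2\<^esub> 2"
  proof -
    \<comment> \<open>\<open>(1 + y^2) / y = 2 + (y - 1)^2 / y\<close>, and \<open>y - 1\<close> is divisible by \<open>p\<close>\<close>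
    have "1 / (16 * y) * (t\<^sup>2 + 16 * s\<^sup>2) \<approx>\<^bsub>2\<^esub> 1 / (16 * y) * (4\<^sup>2 + 16 * y\<^sup>2)"
      using y by (intro rcong_scale rcong_add rcong_power t s) simp_all
    also have "\<dots> = 2 + (y - 1)\<^sup>2 / y"
      using y by (simp add: field_simps power2_eq_square)
    also have "\<dots> \<approx>\<^bsub>2\<^esub> 2"
    proof -
      obtain z where z: "integral z" "y - 1 = P * z"
        using power_16_cong_1 unfolding y_def rcong_iff by auto
      then show ?thesis
        using y by (intro rcongI[where z = "z\<^sup>2 / y"]) (simp_all add: power_mult_distrib)
    qed
    finally show ?thesis by simp
  qed
  have product: "t * s / y \<approx>\<^bsub>4\<^esub> 4"
    using rcong_scale[OF _ ts, of "1 / y"] y by simp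
  have "{0..p - 1} = {..<p}" using assms by auto
  then have "(\<Sum>n=0..p-1. (3 * (2 * of_nat n + 1) ^ 5 - 2 * (2 * of_nat n + 1) ^ 3 - (2 * of_nat n + 1))
        * ((of_nat (T n))\<^sup>2 / 16 ^ n))
    = - 2 * (P ^ 6 * (t\<^sup>2 + 16 * s\<^sup>2) - 8 * P ^ 4 * (3 * P ^ 2 - 2) * t * s) / (16 ^ p)"
    unfolding t_def s_def by (simp only: weighted_sum_T_squared)
  also have "(16 ^ p :: rat) = 16 * y"
    unfolding y_def using assms by (simp flip: power_Suc)
  also have "- 2 * (P ^ 6 * (t\<^sup>2 + 16 * s\<^sup>2) - 8 * P ^ 4 * (3 * P ^ 2 - 2) * t * s) / (16 * y)
    = - 2 * (P ^ 6 * ((t\<^sup>2 + 16 * s\<^sup>2) / (16 * y)))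
      + (3 * P ^ 2 - 2) * (P ^ 4 * (t * s / y))"
    using y by (simp add: field_simps)
  also have "\<dots> \<approx>\<^bsub>8\<^esub> - 2 * (P ^ 6 * 2) + (3 * P ^ 2 - 2) * (P ^ 4 * 4)"
    by (intro rcong_add rcong_mult_P_power[OF squares] rcong_mult_P_power[OF product] rcong_scale)
      simp_all
  also have "\<dots> = - 8 * P ^ 4 + 8 * P ^ 6"
    by (simp add: algebra_simps eval_nat_numeral)
  finally show ?thesis .
qed

end
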